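(* Let $k$ be a positive integer and $n\ge 0$ an integer. Then $$F_{n,k}(q):=\prod_{m=1}^{n}\frac{(1-q^{km})(1-q^{k(m-1)+1})}{(1-q^m)^2}$$ is a polynomial in $q$ with integer coefficients.
   Context: The empty product equals $1$. *)

theory Defs
  imports "HOL-Computational_Algebra.Polynomial_Factorial"
begin

text \<open>
  Rational functions in \<open>q\<close> are elements of the fraction field of \<open>\<int>[q]\<close>, which is \<open>\<rat>(q)\<close>;
  its subring \<open>\<int>[q]\<close> is \<open>range to_fract\<close>.
\<close>

definition q :: "int poly fract" where
  "q = to_fract (monom 1 1)"

text \<open>
  The truncated subtraction in \<open>k * (m - 1) + 1\<close> is harmless because \<open>m \<ge> 1\<close>. The denominators
  are nonzero for the same reason.
\<close>

definition F :: "nat \<Rightarrow> nat \<Rightarrow> int poly fract" where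
  "F n k = (\<Prod>m = 1..n. ((1 - q ^ (k * m)) * (1 - q ^ (k * (m - 1) + 1))) / (1 - q ^ m) ^ 2)"

end

theory Submission
  imports Defs "HOL-Computational_Algebra.Fundamental_Theorem_Algebra"
begin

text \<open>
  A monic integer polynomial that divides another one over \<open>\<complex>\<close> already divides it over \<open>\<int>\<close>,
  and over \<open>\<complex>\<close> divisibility amounts to comparing root multiplicities. All roots are roots of
  unity, and each factor \<open>q ^ j - 1\<close> has only simple roots, so at a root of unity of order \<open>d\<close>
  the claim is that among \<open>1 \<le> m \<le> n\<close> the number of \<open>m\<close> with \<open>d dvd k * m\<close> plus the number of \<open>m\<close>
  with \<open>d dvd k * (m - 1) + 1\<close> is at least twice the number of multiples of \<open>d\<close>. If \<open>k\<close> and \<open>d\<close>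
  are coprime, each of the two numbers suffices for one copy; otherwise, with \<open>g = gcd k d > 1\<close>,
  the first set already contains the multiples of \<open>d\<close> and their shifts by \<open>- d div g\<close>.
\<close>

subsection \<open>Divisibility of integer polynomials\<close>

lemma map_poly_of_int_add:
  "map_poly of_int (p + r) = (map_poly of_int p + map_poly of_int r :: 'a::comm_ring_1 poly)"
  by (rule poly_eqI) (simp add: coeff_map_poly)

lemma map_poly_of_int_diff:
  "map_poly of_int (p - r) = (map_poly of_int p - map_poly of_int r :: 'a::comm_ring_1 poly)"
  by (rule poly_eqI) (simp add: coeff_map_poly)

lemma map_poly_of_int_mult:
  "map_poly of_int (p * r) = (map_poly of_int p * map_poly of_int r :: 'a::comm_ring_1 poly)"
  by (rule poly_eqI) (simp add: coeff_map_poly coeff_mult)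

lemma map_poly_of_int_prod:
  "map_poly of_int (prod f A) = (\<Prod>x\<in>A. map_poly of_int (f x) :: 'a::comm_ring_1 poly)"
  by (induction A rule: infinite_finite_induct) (auto simp: map_poly_of_int_mult)

text \<open>As \<open>p\<close> is monic, pseudo-division is genuine division with remainder over
  the integers. The image of \<open>p\<close> divides that of the remainder \<open>b\<close>, which
  has smaller degree or is zero, so \<open>b = 0\<close>, because characteristic 0 makes the
  coefficient map injective.\<close>

lemma monic_dvd_if_map_poly_dvd:
  fixes p r :: "int poly"
  assumes "lead_coeff p = 1"
    and dvd: "(map_poly of_int p :: 'a::{idom,ring_char_0} poly) dvd map_poly of_int r"
  shows "p dvd r"
proof -
  have "p \<noteq> 0" using assms(1) by auto
  obtain a b where ab: "pseudo_divmod r p = (a, b)" by fastforce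
  from pseudo_divmod[OF \<open>p \<noteq> 0\<close> ab] assms(1)
  have r: "r = p * a + b" and b: "b = 0 \<or> degree b < degree p" by auto
  let ?h = "map_poly of_int :: int poly \<Rightarrow> 'a poly"
  have deg: "degree (?h s) = degree s" for s
    by (rule degree_map_poly) simp
  have "?h p dvd ?h b"
    using dvd unfolding r map_poly_of_int_add map_poly_of_int_mult
    by (simp add: dvd_add_right_iff)
  hence "?h b = 0 \<or> degree p \<le> degree b"
    using dvd_imp_degree_le[of "?h p" "?h b"] by (auto simp: deg)
  with b have "?h b = 0 \<or> b = 0" by auto
  hence "b = 0" by (auto simp: map_poly_eq_0_iff)
  with r show ?thesis by simp
qed

text \<open>Both polynomials split into linear factors, so the products over their roots can be
  compared factor by factor; leading coefficients are units.\<close>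

lemma complex_poly_dvd_if_order_le:
  fixes p r :: "complex poly"
  assumes "p \<noteq> 0" "r \<noteq> 0"
    and ord: "\<And>z. poly p z = 0 \<Longrightarrow> order z p \<le> order z r"
  shows "p dvd r"
proof -
  have "(\<Prod>z|poly p z = 0. [:-z, 1:] ^ order z p) dvd (\<Prod>z|poly r z = 0. [:-z, 1:] ^ order z r)"
  proof (rule prod_dvd_prod_subset2)
    show "finite {z. poly r z = 0}" using \<open>r \<noteq> 0\<close> by (rule poly_roots_finite)
    show "{z. poly p z = 0} \<subseteq> {z. poly r z = 0}"
    proof safe
      fix z assume "poly p z = 0"
      with ord[of z] assms(1) show "poly r z = 0"
        unfolding order_root by linarith
    qed
  qed (use ord in \<open>auto intro: le_imp_power_dvd\<close>)
  hence "smult (lead_coeff p) (\<Prod>z|poly p z = 0. [:-z, 1:] ^ order z p)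
           dvd smult (lead_coeff r) (\<Prod>z|poly r z = 0. [:-z, 1:] ^ order z r)"
    using assms(1) by (simp add: smult_dvd_iff dvd_smult)
  thus ?thesis by (simp only: complex_poly_decompose)
qed

lemma order_prod:
  fixes f :: "'b \<Rightarrow> 'a::idom poly"
  assumes "finite A" "\<And>x. x \<in> A \<Longrightarrow> f x \<noteq> 0"
  shows "order z (prod f A) = (\<Sum>x\<in>A. order z (f x))"
  using assms by (induction A) (auto simp: order_mult)

lemma lead_coeff_monom_minus_one:
  assumes "m > 0"
  shows "lead_coeff (monom 1 m - 1 :: 'a::comm_ring_1 poly) = 1"
proof -
  have "degree (monom 1 m - 1 :: 'a poly) = m"
  proof (rule antisym)
    show "degree (monom 1 m - 1 :: 'a poly) \<le> m"
      by (rule degree_diff_le) (auto simp: degree_monom_le)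
    show "m \<le> degree (monom 1 m - 1 :: 'a poly)"
      using assms by (intro le_degree) simp
  qed
  with assms show ?thesis by simp
qed

text \<open>All roots are simple: the derivative can vanish only at 0, where the polynomial itself
  is -1.\<close>

lemma order_monom_minus_one:
  fixes z :: complex
  assumes "m > 0"
  shows "order z (monom 1 m - 1) = of_bool (z ^ m = 1)"
proof -
  let ?p = "monom 1 m - 1 :: complex poly"
  have "rsquarefree ?p"
    unfolding rsquarefree_roots using assms
    by (auto simp: pderiv_diff pderiv_monom poly_monom zero_power)
  moreover have "order z ?p = 0 \<longleftrightarrow> z ^ m \<noteq> 1"
    by (subst order_eq_0_iff) (use assms in \<open>simp_all add: poly_monom monom_eq_1_iff\<close>)
  ultimately show ?thesis
    unfolding rsquarefree_def by (cases "z ^ m = 1") (metis of_bool_eq_1_iff, simp)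
qed

subsection \<open>Counting exponents divisible by the order of a root of unity\<close>

text \<open>\<open>d\<close> is the multiplicative order of \<open>z\<close>; \<open>m\<close>
  witnesses that it is finite.\<close>

lemma power_eq_1_iff_dvd:
  fixes z :: "'a::field"
  assumes "z ^ m = 1" "m > 0"
  obtains d where "d > 0" "\<And>j. z ^ j = 1 \<longleftrightarrow> d dvd j"
proof
  define d where "d = (LEAST j. j > 0 \<and> z ^ j = 1)"
  have d: "d > 0 \<and> z ^ d = 1"
    unfolding d_def by (rule LeastI[of _ m]) (use assms in auto)
  thus "d > 0" by simp
  fix j
  have "z ^ j = z ^ (d * (j div d) + j mod d)" by simp
  also have "\<dots> = z ^ (j mod d)" using d by (simp only: power_add power_mult) simp
  finally have eq: "z ^ j = z ^ (j mod d)" .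
  have "j mod d = 0" if "z ^ (j mod d) = 1"
  proof (rule ccontr)
    assume "j mod d \<noteq> 0"
    hence "d \<le> j mod d" unfolding d_def using that by (intro Least_le) (auto simp: d_def)
    thus False using d using mod_less_divisor[of d j] by linarith
  qed
  thus "z ^ j = 1 \<longleftrightarrow> d dvd j" unfolding eq by (metis mod_0_imp_dvd dvd_imp_mod_0 power_0)
qed

lemma exists_dvd_linear:
  fixes d k :: nat
  assumes "coprime d k" "d > 0"
  obtains s where "s < d" "d dvd k * s + 1"
proof -
  obtain x a where "d * x = k * a + gcd d k"
    using bezout_nat[of d k] assms(2) by auto
  hence a: "d dvd k * a + 1"
    using assms(1) by (metis coprime_imp_gcd_eq_1 dvd_triv_left)
  \<comment> \<open>Reducing the Bezout coefficient modulo \<open>d\<close> yields the bound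
    \<open>s < d\<close>.\<close>
  have "(k * (a mod d) + 1) mod d = (k * a + 1) mod d"
    using mod_add_left_eq[of "k * (a mod d)" d 1] mod_add_left_eq[of "k * a" d 1]
    by (simp only: mod_mult_right_eq)
  with a have "d dvd k * (a mod d) + 1" by (simp only: dvd_eq_mod_eq_0)
  with assms(2) show ?thesis by (intro that[of "a mod d"]) simp_all
qed

lemma card_dvd_le:
  fixes d k n :: nat
  assumes "d > 0"
  shows "2 * card {m\<in>{1..n}. d dvd m}
           \<le> card {m\<in>{1..n}. d dvd k * m} + card {m\<in>{1..n}. d dvd k * (m - 1) + 1}"
    (is "2 * card ?A \<le> card ?B + card ?C")
proof (cases "coprime d k")
  case True
  then obtain s where s: "s < d" "d dvd k * s + 1"
    using exists_dvd_linear assms by blast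
  have "card ?A \<le> card ?B" by (rule card_mono) auto
  moreover have "card ?A \<le> card ?C"
  proof (rule card_inj_on_le)
    \<comment> \<open>Each multiple \<open>m\<close> of \<open>d\<close> ends a block
      \<open>{m - d + 1..m}\<close> of length \<open>d\<close>. Its image is the element of this
      block that lies in \<open>?C\<close>; \<open>s < d\<close> keeps it at most
      \<open>m\<close>.\<close>
    show "inj_on (\<lambda>m. m - d + (s + 1)) ?A"
      by (rule inj_onI) (auto dest!: dvd_imp_le)
    show "(\<lambda>m. m - d + (s + 1)) ` ?A \<subseteq> ?C"
    proof safe
      fix m assume m: "m \<in> {1..n}" "d dvd m"
      hence "d \<le> m" by (auto dest: dvd_imp_le)
      with m s show "m - d + (s + 1) \<in> {1..n}" by auto
      have "d dvd k * (m - d) + (k * s + 1)"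
        using m by (intro dvd_add[OF _ s(2)]) (simp add: dvd_diff_nat)
      thus "d dvd k * (m - d + (s + 1) - 1) + 1"
        by (simp add: algebra_simps)
    qed
  qed simp
  ultimately show ?thesis by simp
next
  case False
  define g where "g = gcd d k"
  define e where "e = d div g"
  have g: "g dvd d" "g dvd k" "g > 1"
    using False assms by (auto simp: g_def coprime_iff_gcd_eq_1 nat_neq_iff)
  have d: "d = e * g" using g by (simp add: e_def)
  have e: "0 < e" "e < d" using assms g by (auto simp: d)
  \<comment> \<open>Indeed \<open>k * e = (k div g) * d\<close>, so shifting \<open>m\<close> by
    \<open>e\<close> preserves divisibility of \<open>k * m\<close> by \<open>d\<close>.\<close>
  have ke: "d dvd k * e" using g(2) by (auto simp: d elim!: dvdE)
  let ?A' = "(\<lambda>m. m - e) ` ?A"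
  \<comment> \<open>Hence the subtraction \<open>m - e\<close> does not truncate and stays at least
    1.\<close>
  have le: "e < m" if "m \<in> ?A" for m
    using that e by (auto dest: dvd_imp_le)
  have "inj_on (\<lambda>m. m - e) ?A"
    by (rule inj_onI) (use le in \<open>metis (no_types, lifting) less_imp_le eq_diff_iff\<close>)
  hence "card ?A' = card ?A" by (rule card_image)
  moreover have "?A \<inter> ?A' = {}"
  proof -
    have "\<not> d dvd m - e" if "m \<in> ?A" for m
    proof
      assume "d dvd m - e"
      hence "d dvd m - (m - e)" using that by (blast intro: dvd_diff_nat)
      moreover have "m - (m - e) = e" using le[OF that] by simp
      ultimately have "d dvd e" by (simp only:)
      thus False using e by (auto dest: dvd_imp_le)
    qed
    thus ?thesis by blast
  qed
  ultimately have "2 * card ?A = card (?A \<union> ?A')"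
    by (subst card_Un_disjoint) auto
  also have "\<dots> \<le> card ?B"
  proof (rule card_mono)
    have "m - e \<in> ?B" if "m \<in> ?A" for m
      using that le[OF that] ke by (auto simp: diff_mult_distrib2 intro: dvd_diff_nat)
    thus "?A \<union> ?A' \<subseteq> ?B" by auto
  qed simp
  finally show ?thesis by simp
qed

subsection \<open>The quotient\<close>

lemma prod_monom_minus_one_dvd:
  fixes k n :: nat
  assumes "k \<ge> 1"
  shows "(\<Prod>m=1..n. (monom 1 m - 1) ^ 2 :: int poly)
           dvd (\<Prod>m=1..n. (monom 1 (k * m) - 1) * (monom 1 (k * (m - 1) + 1) - 1))"
    (is "?D dvd ?N")
proof (rule monic_dvd_if_map_poly_dvd)
  show "lead_coeff ?D = 1"
    unfolding lead_coeff_prod lead_coeff_power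
    by (rule prod.neutral) (use lead_coeff_monom_minus_one[where 'a = int] in simp)
  let ?e = "\<lambda>j. monom 1 j - 1 :: complex poly"
  let ?D' = "\<Prod>m=1..n. ?e m ^ 2"
  let ?N' = "\<Prod>m=1..n. ?e (k * m) * ?e (k * (m - 1) + 1)"
  have D: "map_poly of_int ?D = ?D'" and N: "map_poly of_int ?N = ?N'"
    by (simp_all only: map_poly_of_int_prod map_poly_of_int_mult map_poly_of_int_diff
          power2_eq_square map_poly_monom map_poly_1' of_int_0 of_int_1)
  \<comment> \<open>All exponents are positive, so no factor degenerates to
    \<open>1 - 1\<close>.\<close>
  have ne: "?e m \<noteq> 0" "?e (k * m) \<noteq> 0" "?e (k * (m - 1) + 1) \<noteq> 0" if "m \<in> {1..n}" for m
    using that assms by (auto simp: monom_eq_1_iff)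
  have "?D' dvd ?N'"
  proof (rule complex_poly_dvd_if_order_le)
    show "?D' \<noteq> 0" "?N' \<noteq> 0" using ne by auto
    fix z assume "poly ?D' z = 0"
    then obtain m where "m \<in> {1..n}" "z ^ m = 1"
      by (auto simp: poly_prod poly_monom)
    then obtain d where "d > 0" and d: "\<And>j. z ^ j = 1 \<longleftrightarrow> d dvd j"
      using power_eq_1_iff_dvd[of z m] by auto
    have count: "(\<Sum>m=1..n. of_bool (P m)) = card {m\<in>{1..n}. P m}" for P
      by (simp add: of_bool_def sum.If_cases Int_def)
    have "order z ?D' = (\<Sum>m=1..n. of_bool (d dvd m) + of_bool (d dvd m))"
      using ne by (subst order_prod)
        (auto simp: power2_eq_square order_mult order_monom_minus_one d intro!: sum.cong)
    also have "\<dots> = 2 * card {m\<in>{1..n}. d dvd m}"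
      by (simp only: sum.distrib count mult_2)
    also have "\<dots> \<le> card {m\<in>{1..n}. d dvd k * m} + card {m\<in>{1..n}. d dvd k * (m - 1) + 1}"
      by (rule card_dvd_le) fact
    also have "\<dots> = (\<Sum>m=1..n. of_bool (d dvd k * m) + of_bool (d dvd k * (m - 1) + 1))"
      by (simp only: sum.distrib count)
    also have "\<dots> = order z ?N'"
    proof (subst order_prod)
      show "(\<Sum>m=1..n. of_bool (d dvd k * m) + of_bool (d dvd k * (m - 1) + 1))
              = (\<Sum>m=1..n. order z (?e (k * m) * ?e (k * (m - 1) + 1)))"
      proof (rule sum.cong)
        fix m assume m: "m \<in> {1..n}"
        have "?e (k * m) * ?e (k * (m - 1) + 1) \<noteq> 0" using ne[OF m] by simp
        moreover have "k * m > 0" using m assms by simp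
        ultimately show "of_bool (d dvd k * m) + of_bool (d dvd k * (m - 1) + 1)
              = order z (?e (k * m) * ?e (k * (m - 1) + 1))"
          by (simp only: order_mult order_monom_minus_one d add_gr_0 zero_less_one simp_thms)
      qed simp
    qed (use ne in auto)
    finally show "order z ?D' \<le> order z ?N'" .
  qed
  thus "(map_poly of_int ?D :: complex poly) dvd map_poly of_int ?N"
    by (simp only: D N)
qed

lemma to_fract_prod: "to_fract (prod f A) = (\<Prod>x\<in>A. to_fract (f x))"
  by (induction A rule: infinite_finite_induct) auto

lemma to_fract_monom_minus_one: "to_fract (monom 1 m - 1) = q ^ m - 1"
proof -
  have "to_fract (monom 1 m) = q ^ m"
  proof (induction m)
    case (Suc m)
    have "monom 1 (Suc m) = monom 1 1 * (monom 1 m :: int poly)" by (simp add: mult_monom)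
    thus ?case using Suc by (simp add: q_def)
  qed simp
  thus ?thesis by simp
qed

theorem theorem4p1:
  fixes n k :: nat
  assumes "k \<ge> 1"
  shows "\<exists>p :: int poly. F n k = to_fract p"
proof -
  let ?D = "\<Prod>m=1..n. (monom 1 m - 1) ^ 2 :: int poly"
  let ?N = "\<Prod>m=1..n. (monom 1 (k * m) - 1) * (monom 1 (k * (m - 1) + 1) - 1) :: int poly"
  obtain p where p: "?N = ?D * p" using prod_monom_minus_one_dvd[OF assms] by (rule dvdE)
  have "?D \<noteq> 0" by (auto simp: monom_eq_1_iff)
  \<comment> \<open>Passing to the monic factors \<open>q ^ j - 1\<close> costs two signs in each
    numerator, which cancel, and a sign under a square in each denominator.\<close>
  have "F n k = (\<Prod>m=1..n. (q ^ (k * m) - 1) * (q ^ (k * (m - 1) + 1) - 1) / (q ^ m - 1) ^ 2)"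
    unfolding F_def
    by (rule prod.cong[OF refl], rule arg_cong2[where f = "(/)"])
      (simp_all add: algebra_simps power2_commute)
  also have "\<dots> = to_fract ?N / to_fract ?D"
    by (simp only: to_fract_prod to_fract_mult power2_eq_square to_fract_monom_minus_one
          prod_dividef)
  also have "\<dots> = to_fract p" using \<open>?D \<noteq> 0\<close> by (simp only: p to_fract_mult) simp
  finally show ?thesis by blast
qed

end
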